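(* For all double stars $DS_{r,s}$ with $r,s\in\mathbb{N}$ and $r \leq s$, we have $$\frac{(s+r-1)n}{2} + o(1)\leq \operatorname{ex}^\star(n, DS_{r,s}) \leq \frac{(s+2r)n}{2},$$ where $o(1)$ denotes a term tending to $0$ as $n\to\infty$ with $r,s$ fixed.
   Context: Graphs are finite and simple, and all colorings are edge colorings. For $r,s\in\mathbb{N}$, the double star $DS_{r,s}$ is the tree formed by taking a single edge $yx$ and appending $r$ leaves to $y$ and $s$ leaves to $x$. A subgraph of an edge-colored graph is rainbow if all its edges have distinct colors. The rainbow Turán number $\operatorname{ex}^\star(n,F)$ is the largest number of edges among those $n$-vertex graphs that have at least one proper edge coloring containing no rainbow subgraph isomorphic to $F$ (subgraphs need not be induced). *)

theory Defs
  imports Complex_Main "HOL-Library.Landau_Symbols"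
begin

type_synonym 'a ugraph = "'a set \<times> 'a set set"

abbreviation verts :: "'a ugraph \<Rightarrow> 'a set" where "verts \<equiv> fst"
abbreviation edges :: "'a ugraph \<Rightarrow> 'a set set" where "edges \<equiv> snd"

definition simple_graph :: "'a ugraph \<Rightarrow> bool" where
  "simple_graph G \<longleftrightarrow> finite (verts G) \<and> (\<forall>e\<in>edges G. e \<subseteq> verts G \<and> card e = 2)"

definition subgraph_of :: "'a ugraph \<Rightarrow> 'a ugraph \<Rightarrow> bool" where
  "subgraph_of H G \<longleftrightarrow> simple_graph H \<and> verts H \<subseteq> verts G \<and> edges H \<subseteq> edges G"

definition isomorphic :: "'a ugraph \<Rightarrow> 'b ugraph \<Rightarrow> bool" where
  "isomorphic G H \<longleftrightarrow>
     (\<exists>f. bij_betw f (verts G) (verts H) \<and>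
       (\<forall>u\<in>verts G. \<forall>v\<in>verts G. {u, v} \<in> edges G \<longleftrightarrow> {f u, f v} \<in> edges H))"

definition proper_edge_coloring :: "'a ugraph \<Rightarrow> ('a set \<Rightarrow> 'c) \<Rightarrow> bool" where
  "proper_edge_coloring G c \<longleftrightarrow>
     (\<forall>e\<in>edges G. \<forall>e'\<in>edges G. e \<noteq> e' \<and> e \<inter> e' \<noteq> {} \<longrightarrow> c e \<noteq> c e')"

definition rainbow :: "'a ugraph \<Rightarrow> ('a set \<Rightarrow> 'c) \<Rightarrow> bool" where
  "rainbow H c \<longleftrightarrow> inj_on c (edges H)"

definition rainbow_free :: "'a ugraph \<Rightarrow> ('a set \<Rightarrow> 'c) \<Rightarrow> 'b ugraph \<Rightarrow> bool" where
  "rainbow_free G c F \<longleftrightarrow> \<not> (\<exists>H. subgraph_of H G \<and> isomorphic H F \<and> rainbow H c)"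

(* Graphs being finite, vertices and colors may be taken to be natural numbers. *)
definition rainbow_turan_sizes :: "nat \<Rightarrow> 'b ugraph \<Rightarrow> nat set" where
  "rainbow_turan_sizes n F =
     {card (edges G) | G :: nat ugraph. simple_graph G \<and> card (verts G) = n \<and>
        (\<exists>c :: nat set \<Rightarrow> nat. proper_edge_coloring G c \<and> rainbow_free G c F)}"

(* The set is finite, and nonempty as soon as F has an edge; see the two lemmas below. *)
definition rainbow_turan :: "nat \<Rightarrow> 'b ugraph \<Rightarrow> nat" where
  "rainbow_turan n F = Max (rainbow_turan_sizes n F)"

datatype ds_vertex = Y | X | LeafY nat | LeafX nat

definition double_star :: "nat \<Rightarrow> nat \<Rightarrow> ds_vertex ugraph" where
  "double_star r s =
     ({Y, X} \<union> LeafY ` {..<r} \<union> LeafX ` {..<s},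
      {{Y, X}} \<union> (\<lambda>i. {Y, LeafY i}) ` {..<r} \<union> (\<lambda>j. {X, LeafX j}) ` {..<s})"

lemma simple_graph_double_star: "simple_graph (double_star r s)"
  by (auto simp: simple_graph_def double_star_def card_insert_if)

lemma finite_rainbow_turan_sizes: "finite (rainbow_turan_sizes n F)"
proof (rule finite_subset)
  show "rainbow_turan_sizes n F \<subseteq> {..2 ^ n}"
  proof
    fix m assume "m \<in> rainbow_turan_sizes n F"
    then obtain G :: "nat ugraph" where G: "simple_graph G" "card (verts G) = n" "m = card (edges G)"
      by (auto simp: rainbow_turan_sizes_def)
    then have fin: "finite (verts G)" and sub: "edges G \<subseteq> Pow (verts G)"
      by (auto simp: simple_graph_def)
    have "card (edges G) \<le> card (Pow (verts G))"
      using fin sub by (intro card_mono) auto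
    with G fin show "m \<in> {..2 ^ n}" by (simp add: card_Pow)
  qed
qed simp

lemma rainbow_turan_sizes_nonempty:
  assumes "simple_graph F" "edges F \<noteq> {}"
  shows "rainbow_turan_sizes n F \<noteq> {}"
proof -
  from assms obtain e where e: "e \<in> edges F" "card e = 2" "e \<subseteq> verts F"
    by (auto simp: simple_graph_def)
  then obtain u v where uv: "{u, v} \<in> edges F" "u \<in> verts F" "v \<in> verts F"
    by (auto simp: card_2_iff)
  let ?G = "({..<n}, {}) :: nat ugraph"
  have "\<not> isomorphic H F" if "subgraph_of H ?G" for H
  proof
    assume "isomorphic H F"
    then obtain f where f: "bij_betw f (verts H) (verts F)"
      "\<forall>u\<in>verts H. \<forall>v\<in>verts H. {u, v} \<in> edges H \<longleftrightarrow> {f u, f v} \<in> edges F"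
      by (auto simp: isomorphic_def)
    from f(1) uv obtain u' v' where "u' \<in> verts H" "v' \<in> verts H" "u = f u'" "v = f v'"
      by (metis bij_betw_def imageE)
    with f(2) uv have "{u', v'} \<in> edges H" by auto
    with that show False by (auto simp: subgraph_of_def)
  qed
  then have "rainbow_free ?G c F" for c :: "nat set \<Rightarrow> nat"
    by (auto simp: rainbow_free_def)
  moreover have "simple_graph ?G" "card (verts ?G) = n"
      "proper_edge_coloring ?G c" for c :: "nat set \<Rightarrow> nat"
    by (auto simp: simple_graph_def proper_edge_coloring_def)
  ultimately have "card (edges ?G) \<in> rainbow_turan_sizes n F"
    unfolding rainbow_turan_sizes_def by blast
  then show ?thesis by blast
qed

end

theory Submission
  imports Defs
begin

text \<open>
  \<^bold>\<open>Upper bound.\<close> Let a properly coloured graph contain adjacent vertices \<open>x\<close> and \<open>y\<close>, where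
  \<open>y\<close> has degree at least \<open>r + 1\<close> and \<open>x\<close> has degree at least \<open>s + 2r + 1\<close>. Choose any \<open>r\<close>
  neighbours of \<open>y\<close> other than \<open>x\<close> as its leaves. They rule out at most \<open>r\<close> of the at least
  \<open>s + 2r\<close> other neighbours of \<open>x\<close> by coincidence of vertices and at most \<open>r\<close> by coincidence of colours,
  so \<open>s\<close> leaves for \<open>x\<close> survive and a rainbow double star appears
  (\<open>rainbow_double_star_of_degrees\<close>). In a graph without rainbow double star, every neighbour of a
  vertex of degree more than \<open>s + 2r\<close> therefore has degree at most \<open>r\<close>. Hence, counting edges
  between the two kinds, the degree sum of these high vertices is at most that of the low vertices,
  those of degree at most \<open>r\<close>. Together, high and low vertices contribute at most \<open>2r\<close> per low vertex,
  and every other vertex contributes at most \<open>s + 2r\<close>, which gives a degree sum of at most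
  \<open>(s + 2r) n\<close> (\<open>degree_sum_le_of_high_low\<close>).

  \<^bold>\<open>Lower bound.\<close> A graph properly coloured with \<open>r + s\<close> colours has no rainbow subgraph with
  \<open>r + s + 1\<close> edges. For \<open>n \<ge> 2 (r + s)\<close>, an \<open>(r + s)\<close>-regular bipartite circulant graph on
  \<open>2 \<lfloor>n/2\<rfloor>\<close> vertices has such a colouring, and its \<open>(r + s) \<lfloor>n/2\<rfloor>\<close> edges are at least
  \<open>(r + s - 1) n / 2\<close>, so the error term can be taken to vanish from there on.
\<close>

section \<open>Neighbourhoods and degree sums\<close>

text \<open>The neighbourhood of a vertex; its cardinality is the degree of the vertex.\<close>

definition nbrs :: "'a ugraph \<Rightarrow> 'a \<Rightarrow> 'a set" where
  "nbrs G v = {u. {v, u} \<in> edges G}"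

lemma nbrs_subset_verts:
  assumes "simple_graph G"
  shows "nbrs G v \<subseteq> verts G"
  using assms by (auto simp: nbrs_def simple_graph_def)

lemma finite_nbrs:
  assumes "simple_graph G"
  shows "finite (nbrs G v)"
  using nbrs_subset_verts[OF assms] assms by (meson finite_subset simple_graph_def)

lemma not_in_own_nbrs:
  assumes "simple_graph G"
  shows "v \<notin> nbrs G v"
  using assms by (auto simp: nbrs_def simple_graph_def)

lemma in_nbrs_commute: "u \<in> nbrs G v \<longleftrightarrow> v \<in> nbrs G u"
  by (simp add: nbrs_def insert_commute)

lemma finite_edges:
  assumes "simple_graph G"
  shows "finite (edges G)"
proof (rule finite_subset)
  show "edges G \<subseteq> Pow (verts G)" using assms by (auto simp: simple_graph_def)
  show "finite (Pow (verts G))" using assms by (simp add: simple_graph_def)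
qed

lemma card_incident_edges:
  assumes "simple_graph G"
  shows "card {e \<in> edges G. v \<in> e} = card (nbrs G v)"
proof -
  have "bij_betw (\<lambda>u. {v, u}) (nbrs G v) {e \<in> edges G. v \<in> e}"
    unfolding bij_betw_def
  proof (intro conjI equalityI subsetI)
    show "inj_on (\<lambda>u. {v, u}) (nbrs G v)"
      by (auto simp: inj_on_def doubleton_eq_iff)
  next
    fix e assume "e \<in> (\<lambda>u. {v, u}) ` nbrs G v"
    then show "e \<in> {e \<in> edges G. v \<in> e}" by (auto simp: nbrs_def)
  next
    fix e assume e: "e \<in> {e \<in> edges G. v \<in> e}"
    then have "card e = 2" using assms by (simp add: simple_graph_def)
    then obtain a b where "e = {a, b}" by (auto simp: card_2_iff)
    with e obtain u where "e = {v, u}" by (auto simp: insert_commute)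
    with e show "e \<in> (\<lambda>u. {v, u}) ` nbrs G v" by (auto simp: nbrs_def)
  qed
  then show ?thesis by (rule bij_betw_same_card[symmetric])
qed

lemma handshake:
  assumes "simple_graph G"
  shows "(\<Sum>v\<in>verts G. card (nbrs G v)) = 2 * card (edges G)"
proof -
  have "(\<Sum>v\<in>verts G. card (nbrs G v)) = (\<Sum>v\<in>verts G. card {e \<in> edges G. v \<in> e})"
    by (simp add: card_incident_edges[OF assms])
  also have "\<dots> = 2 * card (edges G)"
  proof (rule sum_multicount)
    show "finite (verts G)" using assms by (simp add: simple_graph_def)
    show "finite (edges G)" using assms by (rule finite_edges)
    show "\<forall>e\<in>edges G. card {v \<in> verts G. v \<in> e} = 2"
    proof
      fix e assume "e \<in> edges G"
      then have "e \<subseteq> verts G" "card e = 2" using assms by (auto simp: simple_graph_def)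
      moreover from this have "{v \<in> verts G. v \<in> e} = e" by auto
      ultimately show "card {v \<in> verts G. v \<in> e} = 2" by simp
    qed
  qed
  finally show ?thesis .
qed

lemma degree_sum_le_of_nbrs_subset:
  assumes "simple_graph G" "H \<subseteq> verts G" "L \<subseteq> verts G" "\<And>v. v \<in> H \<Longrightarrow> nbrs G v \<subseteq> L"
  shows "(\<Sum>v\<in>H. card (nbrs G v)) \<le> (\<Sum>u\<in>L. card (nbrs G u))"
proof -
  have fin: "finite H" "finite L"
    using assms finite_subset by (auto simp: simple_graph_def)
  have "(\<Sum>v\<in>H. card (nbrs G v)) = card (SIGMA v:H. nbrs G v)"
    using fin finite_nbrs[OF assms(1)] by simp
  also have "\<dots> \<le> card (SIGMA u:L. nbrs G u)"
  proof (rule card_inj_on_le)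
    show "inj_on prod.swap (SIGMA v:H. nbrs G v)" by simp
    show "prod.swap ` (SIGMA v:H. nbrs G v) \<subseteq> (SIGMA u:L. nbrs G u)"
    proof clarsimp
      fix v u assume "v \<in> H" "u \<in> nbrs G v"
      then show "u \<in> L \<and> v \<in> nbrs G u" using assms(4) in_nbrs_commute by fast
    qed
    show "finite (SIGMA u:L. nbrs G u)"
      using fin finite_nbrs[OF assms(1)] by simp
  qed
  also have "\<dots> = (\<Sum>u\<in>L. card (nbrs G u))"
    using fin finite_nbrs[OF assms(1)] by simp
  finally show ?thesis .
qed

lemma degree_sum_le_of_high_low:
  assumes G: "simple_graph G" and "2 * r \<le> D"
    and low: "\<And>v u. \<lbrakk>D < card (nbrs G v); u \<in> nbrs G v\<rbrakk> \<Longrightarrow> card (nbrs G u) \<le> r"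
  shows "(\<Sum>v\<in>verts G. card (nbrs G v)) \<le> D * card (verts G)"
proof -
  define H where "H = {v \<in> verts G. D < card (nbrs G v)}"
  define L where "L = {v \<in> verts G. card (nbrs G v) \<le> r}"
  define M where "M = verts G - H - L"
  have fin: "finite (verts G)" using G by (simp add: simple_graph_def)
  then have finHLM: "finite H" "finite L" "finite M" by (auto simp: H_def L_def M_def)
  have disj: "H \<inter> L = {}" "(H \<union> L) \<inter> M = {}"
    using assms(2) by (auto simp: H_def L_def M_def)
  have split: "verts G = H \<union> L \<union> M" by (auto simp: H_def L_def M_def)
  have "(\<Sum>v\<in>verts G. card (nbrs G v)) =
      (\<Sum>v\<in>H. card (nbrs G v)) + (\<Sum>v\<in>L. card (nbrs G v)) + (\<Sum>v\<in>M. card (nbrs G v))"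
    unfolding split using finHLM disj by (simp add: sum.union_disjoint)
  also have "\<dots> \<le> r * card L + r * card L + D * card M"
  proof -
    have "(\<Sum>v\<in>H. card (nbrs G v)) \<le> (\<Sum>v\<in>L. card (nbrs G v))"
    proof (rule degree_sum_le_of_nbrs_subset[OF G])
      show "nbrs G v \<subseteq> L" if "v \<in> H" for v
        using that low nbrs_subset_verts[OF G, of v] by (auto simp: H_def L_def)
    qed (auto simp: H_def L_def)
    moreover have "(\<Sum>v\<in>L. card (nbrs G v)) \<le> card L * r"
      using sum_bounded_above[of L "\<lambda>v. card (nbrs G v)" r] by (auto simp: L_def)
    moreover have "(\<Sum>v\<in>M. card (nbrs G v)) \<le> card M * D"
    proof -
      have "card (nbrs G v) \<le> D" if "v \<in> M" for v using that by (auto simp: M_def H_def)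
      then show ?thesis using sum_bounded_above[of M "\<lambda>v. card (nbrs G v)" D] by simp
    qed
    ultimately show ?thesis by (simp add: mult.commute)
  qed
  also have "\<dots> = (2 * r) * card L + D * card M" by simp
  also have "\<dots> \<le> D * card L + D * card M" using assms(2) by (intro add_mono mult_right_mono) auto
  also have "\<dots> = D * card (L \<union> M)"
    using finHLM disj by (subst card_Un_disjoint) (auto simp: algebra_simps)
  also have "\<dots> \<le> D * card (verts G)"
    using fin split by (intro mult_left_mono card_mono) auto
  finally show ?thesis .
qed

section \<open>Finding rainbow double stars\<close>

lemma proper_edge_coloring_at_vertex:
  assumes "proper_edge_coloring G c" "v \<in> nbrs G u" "w \<in> nbrs G u" "v \<noteq> w"
  shows "c {u, v} \<noteq> c {u, w}"
proof -
  have "{u, v} \<noteq> {u, w}" using assms(4) by (auto simp: doubleton_eq_iff)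
  moreover have "{u, v} \<inter> {u, w} \<noteq> {}" by simp
  ultimately show ?thesis
    using assms(1-3) by (simp add: proper_edge_coloring_def nbrs_def)
qed

lemma not_rainbow_free_of_embedding:
  assumes G: "simple_graph G" and F: "simple_graph F"
    and inj: "inj_on g (verts F)" and sub: "g ` verts F \<subseteq> verts G"
    and edge: "\<And>e. e \<in> edges F \<Longrightarrow> g ` e \<in> edges G"
    and rb: "inj_on (\<lambda>e. c (g ` e)) (edges F)"
  shows "\<not> rainbow_free G c F"
proof -
  define H where "H = (g ` verts F, (`) g ` edges F)"
  have "simple_graph H"
    unfolding simple_graph_def
  proof (intro conjI ballI)
    show "finite (verts H)" using F by (simp add: H_def simple_graph_def)
    fix e assume "e \<in> edges H"
    then obtain e' where e': "e' \<in> edges F" "e = g ` e'" by (auto simp: H_def)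
    then show "e \<subseteq> verts H" using F by (auto simp: H_def simple_graph_def)
    show "card e = 2" using e' edge G by (simp add: simple_graph_def)
  qed
  then have "subgraph_of H G"
    using sub edge by (auto simp: subgraph_of_def H_def)
  moreover have "isomorphic H F"
    unfolding isomorphic_def
  proof (intro exI[of _ "inv_into (verts F) g"] conjI ballI)
    show "bij_betw (inv_into (verts F) g) (verts H) (verts F)"
      using inj by (simp add: H_def inj_on_imp_bij_betw bij_betw_inv_into)
    fix u v assume "u \<in> verts H" "v \<in> verts H"
    then obtain u' v' where uv: "u' \<in> verts F" "v' \<in> verts F" "u = g u'" "v = g v'"
      by (auto simp: H_def)
    have "{u, v} \<in> edges H \<longleftrightarrow> (\<exists>e\<in>edges F. g ` {u', v'} = g ` e)"
      using uv by (auto simp: H_def)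
    also have "\<dots> \<longleftrightarrow> (\<exists>e\<in>edges F. {u', v'} = e)"
    proof (rule bex_cong[OF refl])
      fix e assume "e \<in> edges F"
      then have "e \<subseteq> verts F" using F by (simp add: simple_graph_def)
      then show "g ` {u', v'} = g ` e \<longleftrightarrow> {u', v'} = e"
        using uv inj by (intro inj_on_image_eq_iff[where C = "verts F"]) auto
    qed
    finally show "{u, v} \<in> edges H \<longleftrightarrow>
        {inv_into (verts F) g u, inv_into (verts F) g v} \<in> edges F"
      using uv inj by simp
  qed
  moreover have "rainbow H c"
    using rb by (auto simp: rainbow_def H_def inj_on_def)
  ultimately show ?thesis unfolding rainbow_free_def by blast
qed

lemma rainbow_double_star_of_leaves:
  assumes G: "simple_graph G" and c: "proper_edge_coloring G c"
    and xy: "x \<in> nbrs G y"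
    and A: "A \<subseteq> nbrs G y - {x}" "card A = r"
    and B: "B \<subseteq> nbrs G x - {y}" "card B = s"
    and disj: "A \<inter> B = {}"
    and colors: "\<And>a b. \<lbrakk>a \<in> A; b \<in> B\<rbrakk> \<Longrightarrow> c {y, a} \<noteq> c {x, b}"
  shows "\<not> rainbow_free G c (double_star r s)"
proof -
  have yx: "y \<in> nbrs G x" using xy by (simp add: in_nbrs_commute)
  have "finite A" "finite B"
    by (rule finite_subset[OF A(1)], simp add: finite_nbrs[OF G])
      (rule finite_subset[OF B(1)], simp add: finite_nbrs[OF G])
  then obtain a b where a: "bij_betw a {..<r} A" and b: "bij_betw b {..<s} B"
    using ex_bij_betw_nat_finite[of A] ex_bij_betw_nat_finite[of B] A(2) B(2)
    by (auto simp: lessThan_atLeast0)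
  define g where "g v = (case v of Y \<Rightarrow> y | X \<Rightarrow> x | LeafY i \<Rightarrow> a i | LeafX j \<Rightarrow> b j)" for v
  have g: "g Y = y" "g X = x" "\<And>i. g (LeafY i) = a i" "\<And>j. g (LeafX j) = b j"
    by (simp_all add: g_def)
  have inA: "a i \<in> A" "a i \<in> nbrs G y" "a i \<noteq> x" "a i \<noteq> y" if "i < r" for i
  proof -
    show "a i \<in> A" using a that by (auto simp: bij_betw_def)
    then show "a i \<in> nbrs G y" "a i \<noteq> x" "a i \<noteq> y" using A not_in_own_nbrs[OF G] by auto
  qed
  have inB: "b j \<in> B" "b j \<in> nbrs G x" "b j \<noteq> x" "b j \<noteq> y" if "j < s" for j
  proof -
    show "b j \<in> B" using b that by (auto simp: bij_betw_def)
    then show "b j \<in> nbrs G x" "b j \<noteq> x" "b j \<noteq> y" using B not_in_own_nbrs[OF G] by auto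
  qed
  have ainj: "a i = a i' \<longleftrightarrow> i = i'" if "i < r" "i' < r" for i i'
    using a that by (auto simp: bij_betw_def inj_on_def)
  have binj: "b j = b j' \<longleftrightarrow> j = j'" if "j < s" "j' < s" for j j'
    using b that by (auto simp: bij_betw_def inj_on_def)
  have ab: "a i \<noteq> b j" if "i < r" "j < s" for i j
    using inA(1)[OF that(1)] inB(1)[OF that(2)] disj by auto
  have x_ne_y: "x \<noteq> y" using xy not_in_own_nbrs[OF G] by auto
  have cA: "c {y, a i} \<noteq> c {y, x}" "c {y, x} \<noteq> c {y, a i}" if "i < r" for i
    using proper_edge_coloring_at_vertex[OF c inA(2)[OF that] xy] inA(3)[OF that] by auto
  have cB: "c {x, b j} \<noteq> c {y, x}" "c {y, x} \<noteq> c {x, b j}" if "j < s" for j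
    using proper_edge_coloring_at_vertex[OF c inB(2)[OF that] yx] inB(4)[OF that]
    by (auto simp: insert_commute)
  have cAA: "c {y, a i} = c {y, a i'} \<longleftrightarrow> i = i'" if "i < r" "i' < r" for i i'
    using proper_edge_coloring_at_vertex[OF c inA(2)[OF that(1)] inA(2)[OF that(2)]] ainj[OF that]
    by auto
  have cBB: "c {x, b j} = c {x, b j'} \<longleftrightarrow> j = j'" if "j < s" "j' < s" for j j'
    using proper_edge_coloring_at_vertex[OF c inB(2)[OF that(1)] inB(2)[OF that(2)]] binj[OF that]
    by auto
  have cAB: "c {y, a i} \<noteq> c {x, b j}" "c {x, b j} \<noteq> c {y, a i}" if "i < r" "j < s" for i j
    using colors[OF inA(1)[OF that(1)] inB(1)[OF that(2)]] by auto
  have edgesG: "{y, x} \<in> edges G" "\<And>i. i < r \<Longrightarrow> {y, a i} \<in> edges G"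
      "\<And>j. j < s \<Longrightarrow> {x, b j} \<in> edges G"
    using xy inA(2) inB(2) by (auto simp: nbrs_def)
  show ?thesis
  proof (rule not_rainbow_free_of_embedding[OF G simple_graph_double_star])
    show "inj_on g (verts (double_star r s))"
    proof (rule inj_onI)
      fix u v assume "u \<in> verts (double_star r s)" "v \<in> verts (double_star r s)" "g u = g v"
      then show "u = v"
        by (cases u; cases v)
          (simp_all add: double_star_def g ainj binj ab ab[symmetric] image_iff
            x_ne_y x_ne_y[symmetric]
            inA(3,4) inB(3,4) inA(3,4)[symmetric] inB(3,4)[symmetric])
    qed
    show "g ` verts (double_star r s) \<subseteq> verts G"
    proof -
      have "x \<in> verts G" "y \<in> verts G" using xy yx nbrs_subset_verts[OF G] by blast+
      moreover have "a i \<in> verts G" if "i < r" for i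
        using inA(2)[OF that] nbrs_subset_verts[OF G] by blast
      moreover have "b j \<in> verts G" if "j < s" for j
        using inB(2)[OF that] nbrs_subset_verts[OF G] by blast
      ultimately show ?thesis by (auto simp: double_star_def g)
    qed
    show "g ` e \<in> edges G" if "e \<in> edges (double_star r s)" for e
      using that edgesG by (auto simp: double_star_def g)
    show "inj_on (\<lambda>e. c (g ` e)) (edges (double_star r s))"
    proof (rule inj_onI)
      fix e e' assume e: "e \<in> edges (double_star r s)" and e': "e' \<in> edges (double_star r s)"
        and eq: "c (g ` e) = c (g ` e')"
      have "f = {Y, X} \<or> (\<exists>i<r. f = {Y, LeafY i}) \<or> (\<exists>j<s. f = {X, LeafX j})"
        if "f \<in> edges (double_star r s)" for f
        using that by (auto simp: double_star_def)
      from this[OF e] this[OF e'] show "e = e'"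
        by (elim disjE exE conjE; use eq in \<open>simp add: g cA cB cAA cBB cAB\<close>)
    qed
  qed
qed

lemma rainbow_double_star_of_degrees:
  assumes G: "simple_graph G" and c: "proper_edge_coloring G c"
    and xy: "x \<in> nbrs G y"
    and dy: "r < card (nbrs G y)" and dx: "s + 2 * r < card (nbrs G x)"
  shows "\<not> rainbow_free G c (double_star r s)"
proof -
  have yx: "y \<in> nbrs G x" using xy by (simp add: in_nbrs_commute)
  have fin: "finite (nbrs G x)" "finite (nbrs G y)" using finite_nbrs[OF G] by auto
  have "r \<le> card (nbrs G y - {x})" using dy xy fin by simp
  then obtain A where A: "A \<subseteq> nbrs G y - {x}" "card A = r" and finA: "finite A"
    by (rule obtain_subset_with_card_n)
  \<comment> \<open>the neighbours of \<open>x\<close> whose edge repeats a colour already used at \<open>y\<close>\<close>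
  define Z where "Z = {v \<in> nbrs G x. c {x, v} \<in> (\<lambda>a. c {y, a}) ` A}"
  have "card Z \<le> card ((\<lambda>a. c {y, a}) ` A)"
  proof (rule card_inj_on_le)
    show "inj_on (\<lambda>v. c {x, v}) Z"
      using proper_edge_coloring_at_vertex[OF c] by (auto simp: inj_on_def Z_def)
  qed (use finA in \<open>auto simp: Z_def\<close>)
  also have "\<dots> \<le> r" using card_image_le[OF finA] A(2) by blast
  finally have Z: "card Z \<le> r" .
  have finZ: "finite Z" using fin by (simp add: Z_def)
  have "card (nbrs G x) - 1 - card A - card Z \<le> card (nbrs G x - {y} - A - Z)"
    using diff_card_le_card_Diff[OF finA, of "nbrs G x - {y}"]
      diff_card_le_card_Diff[OF finZ, of "nbrs G x - {y} - A"] yx fin by simp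
  then have "s \<le> card (nbrs G x - {y} - A - Z)" using dx Z A(2) by linarith
  then obtain B where B: "B \<subseteq> nbrs G x - {y} - A - Z" "card B = s"
    by (rule obtain_subset_with_card_n)
  show ?thesis
  proof (rule rainbow_double_star_of_leaves[OF G c xy A])
    show "B \<subseteq> nbrs G x - {y}" "card B = s" "A \<inter> B = {}" using B by auto
    show "c {y, a} \<noteq> c {x, b}" if "a \<in> A" "b \<in> B" for a b
    proof
      assume "c {y, a} = c {x, b}"
      then have "c {x, b} \<in> (\<lambda>a. c {y, a}) ` A" using that(1) by (rule image_eqI[OF sym])
      then show False using B(1) that(2) by (auto simp: Z_def)
    qed
  qed
qed

section \<open>Graphs coloured with few colours\<close>

lemma card_edges_double_star: "card (edges (double_star r s)) = r + s + 1"
proof -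
  have inj: "inj_on (\<lambda>i. {Y, LeafY i}) {..<r}" "inj_on (\<lambda>j. {X, LeafX j}) {..<s}"
    by (auto simp: inj_on_def doubleton_eq_iff)
  have "{Y, X} \<notin> (\<lambda>i. {Y, LeafY i}) ` {..<r} \<union> (\<lambda>j. {X, LeafX j}) ` {..<s}"
    "(\<lambda>i. {Y, LeafY i}) ` {..<r} \<inter> (\<lambda>j. {X, LeafX j}) ` {..<s} = {}"
    by (auto simp: doubleton_eq_iff)
  then show ?thesis
    using inj by (simp add: double_star_def card_Un_disjoint card_image)
qed

lemma card_edges_le_of_isomorphic:
  assumes "simple_graph H" "simple_graph F" "isomorphic H F"
  shows "card (edges F) \<le> card (edges H)"
proof -
  obtain f where f: "bij_betw f (verts H) (verts F)"
    "\<forall>u\<in>verts H. \<forall>v\<in>verts H. {u, v} \<in> edges H \<longleftrightarrow> {f u, f v} \<in> edges F"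
    using assms(3) by (auto simp: isomorphic_def)
  have "edges F \<subseteq> (`) f ` edges H"
  proof
    fix e assume e: "e \<in> edges F"
    then have "card e = 2" "e \<subseteq> verts F" using assms(2) by (auto simp: simple_graph_def)
    then obtain u v where uv: "e = {u, v}" "u \<in> verts F" "v \<in> verts F"
      by (auto simp: card_2_iff)
    have "verts F = f ` verts H" using f(1) by (simp add: bij_betw_def)
    with uv(2,3) obtain u' v' where uv': "u' \<in> verts H" "v' \<in> verts H" "u = f u'" "v = f v'"
      by blast
    then have "{u', v'} \<in> edges H" using f(2) e uv(1) by simp
    moreover have "e = f ` {u', v'}" using uv(1) uv'(3,4) by simp
    ultimately show "e \<in> (`) f ` edges H" by blast
  qed
  then show ?thesis by (rule surj_card_le[OF finite_edges[OF assms(1)]])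
qed

lemma rainbow_free_of_few_colors:
  fixes c :: "'a set \<Rightarrow> nat"
  assumes "simple_graph F" "\<And>e. e \<in> edges G \<Longrightarrow> c e < d" "d < card (edges F)"
  shows "rainbow_free G c F"
  unfolding rainbow_free_def
proof (intro notI, elim exE conjE)
  fix H assume H: "subgraph_of H G" "isomorphic H F" "rainbow H c"
  have "card (edges F) \<le> card (edges H)"
    using H assms(1) by (intro card_edges_le_of_isomorphic) (auto simp: subgraph_of_def)
  also have "\<dots> \<le> card {..<d}"
  proof (rule card_inj_on_le)
    show "inj_on c (edges H)" using H(3) by (simp add: rainbow_def)
    show "c ` edges H \<subseteq> {..<d}" using H(1) assms(2) by (auto simp: subgraph_of_def)
  qed simp
  finally show False using assms(3) by simp
qed

text \<open>
  The bipartite circulant graph with sides \<open>{0, \<dots>, m - 1}\<close> and \<open>{m, \<dots>, 2m - 1}\<close>: for each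
  \<open>k < d\<close>, the vertex \<open>i\<close> is joined to the vertex \<open>m + (i + k) mod m\<close>. The vertex set is
  \<open>{0, \<dots>, n - 1}\<close>, where \<open>2 m \<le> n\<close> is intended; vertices from \<open>2 m\<close> on are isolated.
\<close>

definition circulant :: "nat \<Rightarrow> nat \<Rightarrow> nat \<Rightarrow> nat ugraph" where
  "circulant n m d = ({..<n}, (\<lambda>(i, k). {i, m + (i + k) mod m}) ` ({..<m} \<times> {..<d}))"

text \<open>
  The larger endpoint minus the smaller one recovers the shift \<open>k\<close> modulo \<open>m\<close>. For \<open>d \<le> m\<close>
  different shifts get different colours, and each shift is a perfect matching between the two
  sides, so this is a proper colouring.
\<close>

definition circulant_coloring :: "nat \<Rightarrow> nat set \<Rightarrow> nat" where
  "circulant_coloring m e = (Max e - Min e) mod m"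

lemma circulant_coloring_edge:
  assumes "i < m" "k < m"
  shows "circulant_coloring m {i, m + (i + k) mod m} = k"
proof -
  have "Max {i, m + (i + k) mod m} = m + (i + k) mod m" "Min {i, m + (i + k) mod m} = i"
    using assms by auto
  moreover have "(m + (i + k) mod m - i) mod m = k"
  proof (cases "i + k < m")
    case True
    then show ?thesis using assms by simp
  next
    case False
    then have "(i + k) mod m = i + k - m" using assms by (simp add: mod_if)
    then show ?thesis using assms False by simp
  qed
  ultimately show ?thesis by (simp add: circulant_coloring_def)
qed

lemma circulant_edgeE:
  assumes "e \<in> edges (circulant n m d)" "d \<le> m"
  obtains i k where "i < m" "k < d" "e = {i, m + (i + k) mod m}" "circulant_coloring m e = k"
  using assms circulant_coloring_edge by (auto simp: circulant_def)

lemma simple_graph_circulant: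
  assumes "2 * m \<le> n"
  shows "simple_graph (circulant n m d)"
  unfolding simple_graph_def
proof (intro conjI ballI)
  fix e assume "e \<in> edges (circulant n m d)"
  then obtain i k where "i < m" "e = {i, m + (i + k) mod m}"
    by (auto simp: circulant_def)
  moreover from this have "(i + k) mod m < m" by simp
  then have "m + (i + k) mod m < n" using assms by linarith
  ultimately show "e \<subseteq> verts (circulant n m d)" "card e = 2"
    using assms by (auto simp: circulant_def card_insert_if)
qed (simp add: circulant_def)

lemma add_mod_left_inj:
  fixes i j k m :: nat
  assumes "i < m" "j < m" "(i + k) mod m = (j + k) mod m"
  shows "i = j"
proof -
  have "(int i + int k) mod int m = (int j + int k) mod int m"
    using assms(3) by (metis of_nat_add of_nat_mod)
  then have "int m dvd int i - int j" by (simp add: mod_eq_dvd_iff)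
  moreover have "\<bar>int i - int j\<bar> < int m" using assms(1,2) by linarith
  ultimately have "int i - int j = 0" using dvd_imp_le_int[of "int i - int j" "int m"] by fastforce
  then show ?thesis by simp
qed

lemma proper_circulant_coloring:
  assumes "d \<le> m"
  shows "proper_edge_coloring (circulant n m d) (circulant_coloring m)"
  unfolding proper_edge_coloring_def
proof (intro ballI impI notI)
  fix e e' assume e: "e \<in> edges (circulant n m d)" and e': "e' \<in> edges (circulant n m d)"
    and ne: "e \<noteq> e' \<and> e \<inter> e' \<noteq> {}"
    and eq: "circulant_coloring m e = circulant_coloring m e'"
  obtain i k where ik: "i < m" "e = {i, m + (i + k) mod m}" "circulant_coloring m e = k"
    using e assms by (rule circulant_edgeE)
  obtain j l where jl: "j < m" "e' = {j, m + (j + l) mod m}" "circulant_coloring m e' = l"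
    using e' assms by (rule circulant_edgeE)
  have "i = j \<or> (i + k) mod m = (j + l) mod m"
  proof -
    have "i \<noteq> m + (j + l) mod m" "j \<noteq> m + (i + k) mod m" using ik(1) jl(1) by linarith+
    then show ?thesis using ne unfolding ik(2) jl(2) by auto
  qed
  then have "i = j" using add_mod_left_inj[of i m j k] ik jl eq by auto
  then show False using ne ik jl eq by simp
qed

lemma card_edges_circulant:
  assumes "d \<le> m"
  shows "card (edges (circulant n m d)) = d * m"
proof -
  have "inj_on (\<lambda>(i, k). {i, m + (i + k) mod m}) ({..<m} \<times> {..<d})"
  proof (rule inj_onI, clarsimp)
    fix i k j l assume *: "i < m" "k < d" "j < m" "l < d"
      and eq: "{i, m + (i + k) mod m} = {j, m + (j + l) mod m}"
    have "k = l" using circulant_coloring_edge[of i m k] circulant_coloring_edge[of j m l] * eq assms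
      by simp
    moreover have "i = j" using eq * by (auto simp: doubleton_eq_iff)
    ultimately show "i = j \<and> k = l" by simp
  qed
  then show ?thesis by (simp add: circulant_def card_image)
qed

section \<open>The bounds\<close>

lemma rainbow_turan_sizes_double_star_nonempty: "rainbow_turan_sizes n (double_star r s) \<noteq> {}"
  by (rule rainbow_turan_sizes_nonempty[OF simple_graph_double_star]) (simp add: double_star_def)

lemma rainbow_turan_double_star_le:
  "2 * rainbow_turan n (double_star r s) \<le> (s + 2 * r) * n"
proof -
  have "rainbow_turan n (double_star r s) \<in> rainbow_turan_sizes n (double_star r s)"
    unfolding rainbow_turan_def
    by (intro Max_in finite_rainbow_turan_sizes rainbow_turan_sizes_double_star_nonempty)
  then obtain G :: "nat ugraph" and c :: "nat set \<Rightarrow> nat"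
    where G: "simple_graph G" "card (verts G) = n" and c: "proper_edge_coloring G c"
      and free: "rainbow_free G c (double_star r s)"
      and size: "rainbow_turan n (double_star r s) = card (edges G)"
    by (auto simp: rainbow_turan_sizes_def)
  have "(\<Sum>v\<in>verts G. card (nbrs G v)) \<le> (s + 2 * r) * card (verts G)"
  proof (rule degree_sum_le_of_high_low[OF G(1), of r])
    fix v u assume "s + 2 * r < card (nbrs G v)" "u \<in> nbrs G v"
    then show "card (nbrs G u) \<le> r"
      using rainbow_double_star_of_degrees[OF G(1) c, of v u r s] free in_nbrs_commute[of u G v]
      by (auto simp: not_less[symmetric])
  qed simp
  then show ?thesis using handshake[OF G(1)] size G(2) by simp
qed

lemma rainbow_turan_double_star_ge:
  assumes "2 * (r + s) \<le> n"
  shows "(r + s) * (n div 2) \<le> rainbow_turan n (double_star r s)"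
proof -
  let ?m = "n div 2" and ?d = "r + s"
  have dm: "?d \<le> ?m" using div_le_mono[OF assms, of 2] by simp
  have "simple_graph (circulant n ?m ?d)" by (rule simple_graph_circulant) simp
  moreover have "card (verts (circulant n ?m ?d)) = n" by (simp add: circulant_def)
  moreover have "rainbow_free (circulant n ?m ?d) (circulant_coloring ?m) (double_star r s)"
    using dm by (intro rainbow_free_of_few_colors[OF simple_graph_double_star, of _ _ ?d])
      (auto simp: card_edges_double_star elim: circulant_edgeE)
  ultimately have "card (edges (circulant n ?m ?d)) \<in> rainbow_turan_sizes n (double_star r s)"
    unfolding rainbow_turan_sizes_def using proper_circulant_coloring[OF dm, of n] by blast
  then show ?thesis
    unfolding rainbow_turan_def card_edges_circulant[OF dm]
    by (intro Max_ge finite_rainbow_turan_sizes)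
qed

theorem theorem4p7:
  fixes r s :: nat
  assumes "r \<le> s"
  shows "(\<exists>\<epsilon> :: nat \<Rightarrow> real. \<epsilon> \<in> o(\<lambda>_. 1) \<and>
           (\<forall>n. (real s + real r - 1) * real n / 2 + \<epsilon> n
                  \<le> real (rainbow_turan n (double_star r s)))) \<and>
         (\<forall>n. real (rainbow_turan n (double_star r s))
                  \<le> (real s + 2 * real r) * real n / 2)"
proof (intro conjI allI)
  \<comment> \<open>for small \<open>n\<close> this makes the left-hand side \<open>- n / 2\<close>, a trivial lower bound\<close>
  define \<epsilon> :: "nat \<Rightarrow> real" where
    "\<epsilon> n = (if 2 * (r + s) \<le> n then 0 else - (real s + real r) * real n / 2)" for n
  have "eventually (\<lambda>n. \<epsilon> n = 0) sequentially"
    using eventually_ge_at_top[of "2 * (r + s)"] by eventually_elim (simp add: \<epsilon>_def)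
  then have "\<epsilon> \<in> o(\<lambda>_. 1)"
    by (intro smalloI_tendsto tendsto_eventually) (auto elim: eventually_mono)
  moreover have "(real s + real r - 1) * real n / 2 + \<epsilon> n
      \<le> real (rainbow_turan n (double_star r s))" for n
  proof (cases "2 * (r + s) \<le> n")
    case True
    have "(real s + real r - 1) * real n \<le> 2 * (real (r + s) * real (n div 2))"
    proof (cases "even n")
      case True
      then have "real n = 2 * real (n div 2)" by (auto elim: evenE)
      then show ?thesis by (simp add: algebra_simps)
    next
      case False
      \<comment> \<open>the isolated vertex lowers the degree sum by \<open>r + s\<close>, which the slack \<open>n\<close> covers\<close>
      then have "real n = 2 * real (n div 2) + 1" by (auto elim: oddE)
      then show ?thesis using \<open>2 * (r + s) \<le> n\<close> by (simp add: algebra_simps)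
    qed
    also have "\<dots> \<le> 2 * real (rainbow_turan n (double_star r s))"
      using rainbow_turan_double_star_ge[OF True]
      by (metis mult_left_mono of_nat_le_iff of_nat_mult zero_le_numeral)
    finally show ?thesis using True by (simp add: \<epsilon>_def)
  next
    case False
    then have "(real s + real r - 1) * real n / 2 + \<epsilon> n = - real n / 2"
      by (simp add: \<epsilon>_def field_simps)
    also have "\<dots> \<le> real (rainbow_turan n (double_star r s))"
      by (rule order_trans[of _ 0]) simp_all
    finally show ?thesis .
  qed
  ultimately show "\<exists>\<epsilon> :: nat \<Rightarrow> real. \<epsilon> \<in> o(\<lambda>_. 1) \<and>
      (\<forall>n. (real s + real r - 1) * real n / 2 + \<epsilon> n
             \<le> real (rainbow_turan n (double_star r s)))"
    by blast
next
  fix n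
  have "real (2 * rainbow_turan n (double_star r s)) \<le> real ((s + 2 * r) * n)"
    using rainbow_turan_double_star_le by (simp only: of_nat_le_iff)
  then show "real (rainbow_turan n (double_star r s)) \<le> (real s + 2 * real r) * real n / 2"
    by simp
qed

end
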